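(* Let $d\ge 1$ be an integer and let $G=\mathbb{R}^d$ or $G=\mathbb{T}^d$. Let $T: L^1(G)\to\mathcal{C}(\hat G)$ be a continuous linear operator such that $T(f*g)=T(f)\,T(g)$ (pointwise product) for all $f,g\in L^1(G)$. Then there exist a set $E\subset\hat G$ and a function $\varphi:\hat G\to\hat G$ such that, for every $f\in L^1(G)$ and every $\xi\in\hat G$, $$T(f)(\xi)=\chi_E(\xi)\,\widehat{f}\bigl(\varphi(\xi)\bigr).$$
   Context: Functions are complex valued. $\mathbb{T}=\mathbb{R}/\mathbb{Z}$, and $G$ carries Lebesgue (Haar) measure. The dual group is $\hat G=\mathbb{R}^d$ if $G=\mathbb{R}^d$ and $\hat G=\mathbb{Z}^d$ if $G=\mathbb{T}^d$. The convolution is $f*g(x)=\int_Gf(t)g(x-t)\,dt$ and the Fourier transform is $\hat f(\xi)=\int_Gf(t)e^{-2i\pi\langle t,\xi\rangle}\,dt$. $\mathcal{C}(\mathbb{R}^d)$ is the space of continuous functions on $\mathbb{R}^d$ (with the topology of uniform convergence on compact sets), and $\mathcal{C}(\mathbb{Z}^d)=L^\infty(\mathbb{Z}^d)$ is the space of bounded functions on $\mathbb{Z}^d$ with the supremum norm. $\chi_E$ is the indicator function of $E$. *)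

theory Defs
  imports "HOL-Analysis.Analysis"
begin

text \<open>
  The dimension is \<open>d = CARD('n)\<close>. A function on the torus is represented by the corresponding
  \<open>\<int>\<^sup>d\<close>-periodic function on \<open>\<real>\<^sup>d\<close>, and Haar measure on the torus by Lebesgue measure on the
  fundamental domain \<open>[0,1)\<^sup>d\<close>. Elements of \<open>L\<^sup>1(G)\<close> are represented by functions; operators on
  \<open>L\<^sup>1(G)\<close> are required to respect equality almost everywhere (see \<open>linear_on_L1\<close>), and their
  values outside the given set of representatives are irrelevant.
\<close>

definition of_int_vec :: "int ^ 'n \<Rightarrow> real ^ 'n::finite" where
  "of_int_vec k = (\<chi> i. real_of_int (k $ i))"

definition torus_measure :: "(real ^ 'n::finite) measure" where
  "torus_measure = lebesgue_on {x. \<forall>i. 0 \<le> x $ i \<and> x $ i < 1}"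

definition L1_Rd :: "(real ^ 'n::finite \<Rightarrow> complex) set" where
  "L1_Rd = {f. integrable lebesgue f}"

definition L1_Td :: "(real ^ 'n::finite \<Rightarrow> complex) set" where
  "L1_Td = {f. integrable torus_measure f \<and> (\<forall>k x. f (x + of_int_vec k) = f x)}"

definition L1_norm :: "'g measure \<Rightarrow> ('g \<Rightarrow> complex) \<Rightarrow> real" where
  "L1_norm M f = (LINT t|M. norm (f t))"

text \<open>
  With \<open>M = torus_measure\<close> the argument \<open>x - t\<close> may leave the fundamental domain; for periodic
  functions this is subtraction in the torus. Where the integrand is not integrable (a null set
  of \<open>x\<close> when \<open>f\<close> and \<open>g\<close> are in \<open>L\<^sup>1\<close>) the value is \<open>0\<close>.
\<close>

definition convolution ::
    "'g::ab_group_add measure \<Rightarrow> ('g \<Rightarrow> complex) \<Rightarrow> ('g \<Rightarrow> complex) \<Rightarrow> 'g \<Rightarrow> complex" where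
  "convolution M f g = (\<lambda>x. LINT t|M. f t * g (x - t))"

definition fourier :: "(real ^ 'n::finite) measure \<Rightarrow> (real ^ 'n \<Rightarrow> complex) \<Rightarrow> real ^ 'n \<Rightarrow> complex" where
  "fourier M f \<xi> = (LINT t|M. f t * exp (- 2 * \<i> * of_real pi * of_real (t \<bullet> \<xi>)))"

definition linear_on_L1 ::
    "'g measure \<Rightarrow> ('g \<Rightarrow> complex) set \<Rightarrow> (('g \<Rightarrow> complex) \<Rightarrow> ('h \<Rightarrow> complex)) \<Rightarrow> bool" where
  "linear_on_L1 M L T \<longleftrightarrow>
     (\<forall>f\<in>L. \<forall>g\<in>L. (AE t in M. f t = g t) \<longrightarrow> T f = T g) \<and>
     (\<forall>f\<in>L. \<forall>g\<in>L. T (\<lambda>t. f t + g t) = (\<lambda>\<xi>. T f \<xi> + T g \<xi>)) \<and>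
     (\<forall>c. \<forall>f\<in>L. T (\<lambda>t. c * f t) = (\<lambda>\<xi>. c * T f \<xi>))"

text \<open>
  Continuity from the \<open>L\<^sup>1\<close> norm to the topology of uniform convergence on the members of \<open>\<K>\<close>:
  the compact sets for \<open>\<C>(\<real>\<^sup>d)\<close>, and the whole space (supremum norm) for \<open>\<C>(\<int>\<^sup>d)\<close>.
\<close>

definition continuous_on_L1 ::
    "'g measure \<Rightarrow> ('g \<Rightarrow> complex) set \<Rightarrow> 'h set set \<Rightarrow> (('g \<Rightarrow> complex) \<Rightarrow> ('h \<Rightarrow> complex)) \<Rightarrow> bool" where
  "continuous_on_L1 M L \<K> T \<longleftrightarrow>
     (\<forall>f\<in>L. \<forall>K\<in>\<K>. \<forall>\<epsilon>>0. \<exists>\<delta>>0. \<forall>g\<in>L. L1_norm M (\<lambda>t. g t - f t) < \<delta> \<longrightarrow>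
        (\<forall>\<xi>\<in>K. dist (T g \<xi>) (T f \<xi>) < \<epsilon>))"

definition multiplicative_on_L1 ::
    "'g::ab_group_add measure \<Rightarrow> ('g \<Rightarrow> complex) set \<Rightarrow> (('g \<Rightarrow> complex) \<Rightarrow> ('h \<Rightarrow> complex)) \<Rightarrow> bool" where
  "multiplicative_on_L1 M L T \<longleftrightarrow>
     (\<forall>f\<in>L. \<forall>g\<in>L. T (convolution M f g) = (\<lambda>\<xi>. T f \<xi> * T g \<xi>))"

end

theory Submission
  imports Defs
begin

text \<open>
  Fix a point \<open>\<xi>\<close> of the dual group. The map \<open>m f = T f \<xi>\<close> is a continuous linear functional on
  \<open>L\<^sup>1(G)\<close> that turns convolution into multiplication, and the claim for \<open>T\<close> says exactly that every
  such functional is either zero or evaluation of the Fourier transform at some point of the dual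
  group: \<open>E\<close> collects the points where the second alternative holds and \<open>\<phi>\<close> chooses the
  frequency (\<open>pointwise_zero_or_transform\<close>).

  On the torus the exponentials \<open>e\<^sub>k\<close> are eigenvectors of every convolution operator,
  \<open>f * e\<^sub>k = F f(k) e\<^sub>k\<close> with \<open>F f(k)\<close> the \<open>k\<close>-th Fourier coefficient. Applying \<open>m\<close>
  gives \<open>m(f) m(e\<^sub>k) = F f(k) m(e\<^sub>k)\<close>, so a single \<open>k\<close> with \<open>m(e\<^sub>k) \<noteq> 0\<close> settles the matter
  (\<open>multiplicative_functional_on_L1_Td\<close>). If there is none, \<open>m\<close>
  vanishes on all trigonometric polynomials, which are dense in \<open>L\<^sup>1\<close>, hence \<open>m = 0\<close>
  (\<open>L1_continuous_vanishing_on_trig_poly\<close>).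

  On \<open>\<real>\<^sup>d\<close> the exponentials are not integrable and translations take over their role. Suppose \<open>m\<close>
  does not vanish at some continuous \<open>u\<close> of compact support, and write \<open>u\<^sub>t\<close> for the translate
  \<open>x \<mapsto> u(x - t)\<close>. From \<open>u\<^sub>s * u\<^sub>t = u * u\<^sub>s\<^sub>+\<^sub>t\<close> it follows that \<open>\<psi>(t) = m(u\<^sub>t) / m(u)\<close> is
  multiplicative. It is also continuous and bounded, so it is a character \<open>t \<mapsto> exp(2\<pi>i t\<bullet>\<zeta>)\<close>
  (\<open>bounded_character_vec\<close>). Since \<open>f * u\<close> is the superposition \<open>\<integral> f(t) u\<^sub>t dt\<close>, the functional
  can be moved under the integral (\<open>functional_of_convolution\<close>), and
  \<open>m(f) m(u) = \<integral> f(t) m(u\<^sub>t) dt = m(u) \<integral> f \<psi>\<close>, which is \<open>m(u)\<close> times the Fourier transform of \<open>f\<close>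
  at \<open>- \<zeta>\<close>. Density of the continuous functions of compact support extends this to \<open>L\<^sup>1\<close>.
\<close>

section \<open>Functionals on \<open>L\<^sup>1\<close> and their continuity\<close>

text \<open>
  Measurable functions are almost everywhere limits of continuous ones; composing these with the
  nearest-point projection onto a disc keeps the bound, which makes dominated convergence applicable.
\<close>

lemma bounded_measurable_limit_of_continuous:
  fixes f :: "'a::euclidean_space \<Rightarrow> complex"
  assumes f: "f \<in> borel_measurable lebesgue" and B: "\<And>x. norm (f x) \<le> B"
  obtains g where "\<And>n::nat. continuous_on UNIV (g n)" "\<And>n x. norm (g n x) \<le> B"
    "AE x in lebesgue. (\<lambda>n. g n x) \<longlonglongrightarrow> f x"
proof -
  have "f measurable_on UNIV"
    using f lebesgue_measurable_imp_measurable_on[of f UNIV] by (simp add: lebesgue_on_UNIV_eq)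
  then obtain N g where N: "negligible N" and g: "\<And>n. continuous_on UNIV (g n)"
    and lim: "\<And>x. x \<notin> N \<Longrightarrow> (\<lambda>n. g n x) \<longlonglongrightarrow> f x"
    unfolding measurable_on_def by auto
  let ?c = "closest_point (cball (0::complex) B)"
  have B0: "0 \<le> B" using B[of 0] norm_ge_zero order_trans by blast
  have c: "continuous_on UNIV ?c"
    by (rule continuous_on_closest_point) (use B0 in auto)
  show thesis
  proof
    show "continuous_on UNIV (\<lambda>x. ?c (g n x))" for n
      by (rule continuous_on_compose2[OF c g]) auto
    show "norm (?c (g n x)) \<le> B" for n x
      using closest_point_in_set[of "cball (0::complex) B" "g n x"] B0 by auto
    have "AE x in lebesgue. x \<notin> N"
      using N by (simp add: negligible_iff_null_sets AE_not_in)
    then show "AE x in lebesgue. (\<lambda>n. ?c (g n x)) \<longlonglongrightarrow> f x"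
    proof eventually_elim
      case (elim x)
      have "(\<lambda>n. ?c (g n x)) \<longlonglongrightarrow> ?c (f x)"
        using c lim[OF elim] by (auto simp: continuous_on_eq_continuous_at intro: isCont_tendsto_compose)
      then show ?case using B[of x] by (simp add: closest_point_self)
    qed
  qed
qed

lemma L1_norm_tendsto_0_dominated:
  fixes f :: "'g \<Rightarrow> complex"
  assumes "f \<in> borel_measurable M" "\<And>n::nat. g n \<in> borel_measurable M" "integrable M w"
    "AE x in M. (\<lambda>n. g n x) \<longlonglongrightarrow> f x"
    "AE x in M. norm (f x) \<le> w x" "\<And>n. AE x in M. norm (g n x) \<le> w x"
  shows "(\<lambda>n. L1_norm M (\<lambda>t. g n t - f t)) \<longlonglongrightarrow> 0"
proof -
  have "(\<lambda>n. LINT t|M. norm (g n t - f t)) \<longlonglongrightarrow> (LINT t|M. 0)"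
  proof (rule integral_dominated_convergence)
    show "integrable M (\<lambda>x. 2 * w x)" using assms by simp
    show "AE x in M. (\<lambda>n. norm (g n x - f x)) \<longlonglongrightarrow> 0"
      using assms(4) by eventually_elim (simp add: tendsto_norm_zero LIM_zero)
    show "AE x in M. norm (norm (g n x - f x)) \<le> 2 * w x" for n
      using assms(5) assms(6)[of n]
      by eventually_elim (use norm_triangle_ineq4 in \<open>smt (verit, best) norm_ge_zero real_norm_def\<close>)
  qed (use assms in auto)
  then show ?thesis by (simp add: L1_norm_def)
qed

text \<open>
  Continuity is taken along sequences because every approximation below comes from dominated
  convergence.
\<close>

definition L1_continuous :: "'g measure \<Rightarrow> ('g \<Rightarrow> complex) set \<Rightarrow> (('g \<Rightarrow> complex) \<Rightarrow> complex) \<Rightarrow> bool" where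
  "L1_continuous M L m \<longleftrightarrow> (\<forall>f\<in>L. \<forall>g. (\<forall>n::nat. g n \<in> L) \<longrightarrow>
     (\<lambda>n. L1_norm M (\<lambda>t. g n t - f t)) \<longlonglongrightarrow> 0 \<longrightarrow> (\<lambda>n. m (g n)) \<longlonglongrightarrow> m f)"

lemma continuous_on_L1_imp_L1_continuous:
  assumes "continuous_on_L1 M L \<K> T" "K \<in> \<K>" "\<xi> \<in> K"
  shows "L1_continuous M L (\<lambda>f. T f \<xi>)"
  unfolding L1_continuous_def
proof (intro ballI allI impI)
  fix f g assume f: "f \<in> L" and g: "\<forall>n::nat. g n \<in> L"
    and lim: "(\<lambda>n. L1_norm M (\<lambda>t. g n t - f t)) \<longlonglongrightarrow> 0"
  show "(\<lambda>n. T (g n) \<xi>) \<longlonglongrightarrow> T f \<xi>"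
  proof (rule tendstoI)
    fix e :: real assume "0 < e"
    then obtain d where d: "d > 0" "\<And>g. g \<in> L \<Longrightarrow> L1_norm M (\<lambda>t. g t - f t) < d \<Longrightarrow> dist (T g \<xi>) (T f \<xi>) < e"
      using assms(1)[unfolded continuous_on_L1_def, rule_format, OF f assms(2) \<open>0 < e\<close>] assms(3) by auto
    from order_tendstoD(2)[OF lim d(1)] show "\<forall>\<^sub>F n in sequentially. dist (T (g n) \<xi>) (T f \<xi>) < e"
      by eventually_elim (use d g in auto)
  qed
qed

lemma L1_continuous_eqI:
  assumes "L1_continuous M L m" "L1_continuous M L m'" "f \<in> L" "\<And>n::nat. g n \<in> L"
    "(\<lambda>n. L1_norm M (\<lambda>t. g n t - f t)) \<longlonglongrightarrow> 0" "\<And>n. m (g n) = m' (g n)"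
  shows "m f = m' f"
proof -
  have "(\<lambda>n. m (g n)) \<longlonglongrightarrow> m f"
    using assms(1)[unfolded L1_continuous_def, rule_format, OF assms(3,4,5)] .
  moreover have "(\<lambda>n. m (g n)) \<longlonglongrightarrow> m' f"
    using assms(2)[unfolded L1_continuous_def, rule_format, OF assms(3,4,5)] by (simp add: assms(6))
  ultimately show ?thesis by (rule LIMSEQ_unique)
qed

lemma L1_continuous_integral_against_bounded:
  assumes L: "\<And>f. f \<in> L \<Longrightarrow> integrable M f" and h: "h \<in> borel_measurable M" "\<And>x. norm (h x) \<le> B"
  shows "L1_continuous M L (\<lambda>f. LINT t|M. f t * h t)"
  unfolding L1_continuous_def
proof (intro ballI allI impI)
  fix f g assume f: "f \<in> L" and g: "\<forall>n::nat. g n \<in> L"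
    and lim: "(\<lambda>n. L1_norm M (\<lambda>t. g n t - f t)) \<longlonglongrightarrow> 0"
  have int: "integrable M (\<lambda>t. k t * h t)" if "integrable M k" for k
    by (rule Bochner_Integration.integrable_bound[of _ "\<lambda>t. B * norm (k t)"])
      (use that h in \<open>auto simp: norm_mult intro!: AE_I2 mult_right_mono order_trans[OF _ abs_ge_self] simp: mult.commute\<close>)
  have le: "norm ((LINT t|M. g n t * h t) - (LINT t|M. f t * h t)) \<le> B * L1_norm M (\<lambda>t. g n t - f t)" for n
  proof -
    have gn: "integrable M (g n)" and fi: "integrable M f" using g f L by auto
    have "(LINT t|M. g n t * h t) - (LINT t|M. f t * h t) = (LINT t|M. (g n t - f t) * h t)"
      using int[OF gn] int[OF fi] by (simp add: left_diff_distrib)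
    also have "norm \<dots> \<le> (LINT t|M. norm ((g n t - f t) * h t))" by simp
    also have "\<dots> \<le> (LINT t|M. B * norm (g n t - f t))"
    proof (rule integral_mono)
      show "integrable M (\<lambda>t. norm ((g n t - f t) * h t))"
        by (intro integrable_norm int Bochner_Integration.integrable_diff gn fi)
    qed (use gn fi h in \<open>auto simp: norm_mult mult.commute intro!: mult_right_mono\<close>)
    finally show ?thesis by (simp add: L1_norm_def)
  qed
  have "(\<lambda>n. B * L1_norm M (\<lambda>t. g n t - f t)) \<longlonglongrightarrow> 0" using tendsto_mult_left[OF lim, of B] by simp
  then have "(\<lambda>n. (LINT t|M. g n t * h t) - (LINT t|M. f t * h t)) \<longlonglongrightarrow> 0"
    by (rule Lim_null_comparison[OF always_eventually[OF allI[OF le]]])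
  then show "(\<lambda>n. LINT t|M. g n t * h t) \<longlonglongrightarrow> (LINT t|M. f t * h t)" by (rule LIM_zero_cancel)
qed

text \<open>
  Truncation reduces density questions in \<open>L\<^sup>1\<close> to bounded functions (and, with suitable \<open>S n\<close>, to
  functions of bounded support).
\<close>

lemma L1_norm_truncation_tendsto_0:
  fixes f :: "'g \<Rightarrow> complex"
  assumes f: "integrable M f" and S: "\<And>n::nat. {x \<in> space M. x \<in> S n} \<in> sets M"
    "\<And>x. \<forall>\<^sub>F n in sequentially. x \<in> S n"
  shows "(\<lambda>n. L1_norm M (\<lambda>t. indicator (S n) t * f t - f t)) \<longlonglongrightarrow> 0"
    and "integrable M (\<lambda>t. indicator (S n) t * f t)"
proof -
  have m: "(\<lambda>x. indicator (S n) x * f x) \<in> borel_measurable M" for n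
    using f S(1)[of n] by (intro borel_measurable_times borel_measurable_indicator') auto
  show "(\<lambda>n. L1_norm M (\<lambda>t. indicator (S n) t * f t - f t)) \<longlonglongrightarrow> 0"
  proof (rule L1_norm_tendsto_0_dominated)
    show "AE x in M. (\<lambda>n. indicator (S n) x * f x) \<longlonglongrightarrow> f x"
    proof (rule AE_I2)
      fix x
      show "(\<lambda>n. indicator (S n) x * f x) \<longlonglongrightarrow> f x"
        by (rule tendsto_eventually, rule eventually_mono[OF S(2)[of x]]) auto
    qed
    show "integrable M (\<lambda>x. norm (f x))" using f by simp
    show "AE x in M. norm (indicator (S n) x * f x) \<le> norm (f x)" for n
      by (auto simp: indicator_def)
  qed (use f m in auto)
  show "integrable M (\<lambda>t. indicator (S n) t * f t)"
    by (rule Bochner_Integration.integrable_bound[OF f m]) (auto simp: indicator_def)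
qed

lemma L1_continuous_zero: "L1_continuous M L (\<lambda>_. 0)"
  by (simp add: L1_continuous_def)

lemma linear_on_L1_add:
  assumes "linear_on_L1 M L T" "f \<in> L" "g \<in> L"
  shows "T (\<lambda>t. f t + g t) \<xi> = T f \<xi> + T g \<xi>"
  using assms(1)[unfolded linear_on_L1_def, THEN conjunct2, THEN conjunct1, rule_format, OF assms(2,3)]
  by (rule fun_cong)

lemma linear_on_L1_scale:
  assumes "linear_on_L1 M L T" "f \<in> L"
  shows "T (\<lambda>t. c * f t) \<xi> = c * T f \<xi>"
  using assms(1)[unfolded linear_on_L1_def, THEN conjunct2, THEN conjunct2, rule_format, OF assms(2)]
  by (rule fun_cong)

lemma multiplicative_on_L1_convolution:
  assumes "multiplicative_on_L1 M L T" "f \<in> L" "g \<in> L"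
  shows "T (convolution M f g) \<xi> = T f \<xi> * T g \<xi>"
  using assms(1)[unfolded multiplicative_on_L1_def, rule_format, OF assms(2,3)] by (rule fun_cong)

text \<open>
  Scaling: a linear map that stays below \<open>1\<close> on a ball of radius \<open>d\<close> has norm at most \<open>1 / d\<close>. As
  \<open>L1_norm M f\<close> may vanish, \<open>f\<close> is scaled by \<open>d / r\<close> with \<open>r\<close> slightly above that norm.
\<close>

lemma linear_continuous_imp_bounded:
  fixes T :: "('g \<Rightarrow> complex) \<Rightarrow> ('h \<Rightarrow> complex)"
  assumes lin: "linear_on_L1 M L T" and cont: "continuous_on_L1 M L \<K> T" and K: "K \<in> \<K>" "\<xi> \<in> K"
    and L: "(\<lambda>_. 0) \<in> L" "\<And>f c. f \<in> L \<Longrightarrow> (\<lambda>t. c * f t) \<in> L"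
  obtains C where "0 \<le> C" "\<And>f. f \<in> L \<Longrightarrow> norm (T f \<xi>) \<le> C * L1_norm M f"
proof -
  have scale: "T (\<lambda>t. c * f t) \<xi> = c * T f \<xi>" if "f \<in> L" for c f
    by (rule linear_on_L1_scale[OF lin that])
  have T0: "T (\<lambda>_. 0) \<xi> = 0" using scale[OF L(1), of 0] by simp
  obtain d where d: "d > 0" "\<And>g. g \<in> L \<Longrightarrow> L1_norm M (\<lambda>t. g t - 0) < d \<Longrightarrow> dist (T g \<xi>) (T (\<lambda>_. 0) \<xi>) < 1"
    using cont[unfolded continuous_on_L1_def, rule_format, OF L(1) K(1) zero_less_one] K(2) by blast
  have "norm (T f \<xi>) \<le> 1 / d * L1_norm M f" if f: "f \<in> L" for f
  proof (rule field_le_epsilon)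
    fix e :: real assume e: "e > 0"
    define r where "r = L1_norm M f + d * e"
    have N: "0 \<le> L1_norm M f" by (simp add: L1_norm_def)
    have r: "r > 0" "L1_norm M f < r" using N e d by (auto simp: r_def add_nonneg_pos)
    define c where "c = complex_of_real (d / r)"
    have nc: "norm c = d / r" unfolding c_def norm_of_real using r d by simp
    have "L1_norm M (\<lambda>t. c * f t - 0) = d / r * L1_norm M f"
      using nc by (simp add: L1_norm_def norm_mult)
    also have "\<dots> < d" using r d by (simp add: field_simps)
    finally have "norm (c * T f \<xi>) < 1" using d(2)[OF L(2)[OF f, of c]] by (simp add: T0 scale[OF f])
    then have "norm (T f \<xi>) < r / d" using r d by (simp add: nc norm_mult field_simps)
    also have "r / d = 1 / d * L1_norm M f + e" using d by (simp add: r_def field_simps)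
    finally show "norm (T f \<xi>) \<le> 1 / d * L1_norm M f + e" by simp
  qed
  then show thesis using d by (intro that[of "1 / d"]) auto
qed

text \<open>
  The alternative may be decided separately at each point; \<open>\<phi>\<close> is arbitrary off \<open>E\<close>, where the
  indicator kills the right-hand side.
\<close>

lemma pointwise_zero_or_transform:
  fixes T :: "('f \<Rightarrow> 'h \<Rightarrow> complex)" and F :: "'f \<Rightarrow> 'k \<Rightarrow> complex"
  assumes "\<And>\<xi>. (\<forall>f\<in>L. T f \<xi> = 0) \<or> (\<exists>\<eta>. \<forall>f\<in>L. T f \<xi> = F f \<eta>)"
  shows "\<exists>E \<phi>. \<forall>f\<in>L. \<forall>\<xi>. T f \<xi> = indicator E \<xi> * F f (\<phi> \<xi>)"
proof -
  let ?E = "{\<xi>. \<exists>\<eta>. \<forall>f\<in>L. T f \<xi> = F f \<eta>}"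
  let ?\<phi> = "\<lambda>\<xi>. SOME \<eta>. \<forall>f\<in>L. T f \<xi> = F f \<eta>"
  have "T f \<xi> = indicator ?E \<xi> * F f (?\<phi> \<xi>)" if "f \<in> L" for f \<xi>
  proof (cases "\<xi> \<in> ?E")
    case True
    then have "\<exists>\<eta>. \<forall>f\<in>L. T f \<xi> = F f \<eta>" by simp
    from bspec[OF someI_ex[OF this] that] show ?thesis using True by simp
  next
    case False
    then have "T f \<xi> = 0" using assms[of \<xi>] that by blast
    then show ?thesis using False by simp
  qed
  then show ?thesis by (intro exI[of _ ?E] exI[of _ ?\<phi>]) blast
qed

section \<open>Characters of \<open>\<real>\<^sup>d\<close>\<close>

definition character :: "real ^ 'n::finite \<Rightarrow> real ^ 'n \<Rightarrow> complex" where
  "character \<eta> x = cis (2 * pi * (x \<bullet> \<eta>))"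

lemma norm_character [simp]: "norm (character \<eta> x) = 1"
  by (simp add: character_def)

lemma continuous_on_character [continuous_intros]: "continuous_on S (character \<eta>)"
  unfolding character_def by (intro continuous_intros)

lemma character_add_left: "character (\<eta> + \<zeta>) x = character \<eta> x * character \<zeta> x"
  by (simp add: character_def cis_mult inner_add_right distrib_left)

lemma character_diff: "character \<eta> (x - t) = character \<eta> x * character (- \<eta>) t"
  by (simp add: character_def cis_mult inner_diff_left right_diff_distrib)

lemma fourier_eq: "fourier M f \<xi> = (LINT t|M. f t * character (- \<xi>) t)"
  unfolding fourier_def character_def cis_conv_exp
  by (intro Bochner_Integration.integral_cong refl) (simp add: mult_ac)

lemma of_int_vec_add: "of_int_vec (k + l) = of_int_vec k + of_int_vec l"
  by (simp add: of_int_vec_def vec_eq_iff)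

lemma of_int_vec_uminus: "of_int_vec (- k) = - of_int_vec k"
  by (simp add: of_int_vec_def vec_eq_iff)

lemma character_of_int_vec_periodic:
  "character (of_int_vec k) (x + of_int_vec l) = character (of_int_vec k) x"
proof -
  have "of_int_vec l \<bullet> of_int_vec k \<in> \<int>"
    by (auto simp: inner_vec_def of_int_vec_def)
  then show ?thesis
    by (simp add: character_def inner_add_left distrib_left flip: cis_mult)
qed

text \<open>
  With \<open>G\<close> a primitive of \<open>\<phi>\<close>, integrating \<open>\<phi>(s + t) = \<phi>(s) \<phi>(t)\<close> over \<open>s \<in> [0, a]\<close> expresses
  \<open>\<phi>(t)\<close> as a multiple of \<open>G(t + a) - G(t)\<close>. So the continuous function \<open>\<phi>\<close> is automatically
  differentiable, it solves \<open>\<phi>' = D \<phi>\<close>, and boundedness on the whole line makes \<open>D\<close> imaginary.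
\<close>

lemma bounded_character_real:
  fixes \<phi> :: "real \<Rightarrow> complex"
  assumes cont: "continuous_on UNIV \<phi>" and mult: "\<And>s t. \<phi> (s + t) = \<phi> s * \<phi> t"
    and one: "\<phi> 0 = 1" and bdd: "\<And>t. norm (\<phi> t) \<le> B"
  obtains c where "\<And>t. \<phi> t = cis (c * t)"
proof -
  have chain: "((\<lambda>t. f (t + c)) has_vector_derivative f') (at x)"
    if "(f has_vector_derivative f') (at (x + c))" for f :: "real \<Rightarrow> complex" and f' x c
  proof -
    have "((\<lambda>t. t + c) has_vector_derivative 1) (at x)"
      unfolding has_real_derivative_iff_has_vector_derivative[symmetric]
      by (auto intro!: derivative_eq_intros)
    from vector_diff_chain_at[OF this that] show ?thesis by (simp add: o_def)
  qed
  have int: "\<phi> integrable_on {a..b}" for a b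
    by (intro integrable_continuous_real continuous_on_subset[OF cont]) simp
  \<comment> \<open>The base point \<open>-1\<close> makes \<open>G\<close> a primitive on a neighbourhood of \<open>0\<close>.\<close>
  define G where "G x = integral {-1..x} \<phi>" for x
  have G: "(G has_vector_derivative \<phi> x) (at x)" if "-1 < x" for x
  proof -
    have "(G has_vector_derivative \<phi> x) (at x within {-1..x + 1})"
      unfolding G_def
      by (rule integral_has_vector_derivative[OF continuous_on_subset[OF cont]]) (use that in auto)
    then show ?thesis using that by (simp add: at_within_Icc_at)
  qed
  \<comment> \<open>Otherwise \<open>G\<close> is constant on the right half-line, so its derivative \<open>\<phi>\<close> vanishes there, while
    \<open>\<phi>(1) \<phi>(-1) = 1\<close>.\<close>
  have "\<exists>a. 0 < a \<and> G a \<noteq> G 0"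
  proof (rule ccontr)
    assume *: "\<not> ?thesis"
    have "((\<lambda>_. G 0) has_vector_derivative \<phi> 1) (at 1)"
      by (rule has_vector_derivative_transform_within_open[OF G, where S="{0<..}"]) (use * in auto)
    then have "\<phi> 1 = 0" using has_vector_derivative_const vector_derivative_unique_at by blast
    then show False using mult[of 1 "-1"] one by simp
  qed
  then obtain a where a: "0 < a" "G a - G 0 \<noteq> 0" by auto
  have shift: "\<phi> t = (G (t + a) - G t) / (G a - G 0)" if "-1 < t" for t
  proof -
    have diff: "G (s + a) - G s = integral {s..s + a} \<phi>" if "-1 < s" for s
    proof -
      have "integral {-1..s} \<phi> + integral {s..s + a} \<phi> = integral {-1..s + a} \<phi>"
        using that a int by (intro Henstock_Kurzweil_Integration.integral_combine) auto
      then show ?thesis unfolding G_def by (metis add_diff_cancel_left')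
    qed
    have "integral {t..t + a} \<phi> = integral {0..a} (\<phi> \<circ> (+) t)"
      using integral_shift_Icc_real[of 0 a \<phi> t] by (simp add: add.commute)
    also have "\<dots> = integral {0..a} \<phi> * \<phi> t" by (simp add: o_def mult mult.commute)
    finally show ?thesis using diff[of 0] diff[OF that] a by simp
  qed
  define D where "D = (\<phi> a - 1) / (G a - G 0)"
  have D0: "(\<phi> has_vector_derivative D) (at 0)"
  proof (rule has_vector_derivative_transform_within_open[where S="{-1<..}"])
    have "((\<lambda>t. G (t + a)) has_vector_derivative \<phi> a) (at 0)"
      using chain[of G "\<phi> a" 0 a] G[of a] a by simp
    then show "((\<lambda>t. (G (t + a) - G t) / (G a - G 0)) has_vector_derivative D) (at 0)"
      unfolding D_def using G[of 0] one
      by (intro has_vector_derivative_divide has_vector_derivative_diff) auto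
  qed (use shift in auto)
  have D: "(\<phi> has_vector_derivative \<phi> t * D) (at t)" for t
  proof -
    have "((\<lambda>x. \<phi> (x - t)) has_vector_derivative D) (at t)"
      using chain[of \<phi> D t "- t"] D0 by simp
    then have "((\<lambda>x. \<phi> t * \<phi> (x - t)) has_vector_derivative \<phi> t * D) (at t)"
      by (rule has_vector_derivative_mult_right)
    then show ?thesis by (simp flip: mult)
  qed
  have "((\<lambda>x. \<phi> x * exp (x *\<^sub>R - D)) has_vector_derivative 0) (at x)" for x
  proof -
    have "((\<lambda>x. \<phi> x * exp (x *\<^sub>R - D)) has_vector_derivative
        \<phi> x * (exp (x *\<^sub>R - D) * - D) + \<phi> x * D * exp (x *\<^sub>R - D)) (at x)"
      by (intro has_vector_derivative_mult D exp_scaleR_has_vector_derivative_right)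
    then show ?thesis by (simp add: mult_ac)
  qed
  then obtain k where "\<And>x. \<phi> x * exp (x *\<^sub>R - D) = k"
    using has_vector_derivative_zero_constant[of UNIV "\<lambda>x. \<phi> x * exp (x *\<^sub>R - D)"] by auto
  moreover from this[of 0] have "k = 1" using one by simp
  ultimately have "\<phi> x = exp (x *\<^sub>R D)" for x by (simp add: exp_minus field_simps)
  then have \<phi>: "\<phi> x = exp (of_real x * D)" for x by (simp add: scaleR_conv_of_real)
  have "Re D = 0"
  proof (rule ccontr)
    assume "Re D \<noteq> 0"
    \<comment> \<open>At \<open>t = B / Re D\<close> the modulus is \<open>exp B > B\<close>.\<close>
    then have "norm (\<phi> (B / Re D)) = exp B" by (simp add: \<phi>)
    then show False using bdd[of "B / Re D"] exp_ge_add_one_self[of B] by linarith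
  qed
  then have "\<phi> x = cis (Im D * x)" for x
    by (simp add: \<phi> exp_eq_polar mult.commute)
  then show thesis by (rule that)
qed

lemma bounded_character_vec:
  fixes \<psi> :: "real ^ 'n::finite \<Rightarrow> complex"
  assumes cont: "continuous_on UNIV \<psi>" and mult: "\<And>s t. \<psi> (s + t) = \<psi> s * \<psi> t"
    and one: "\<psi> 0 = 1" and bdd: "\<And>t. norm (\<psi> t) \<le> B"
  obtains \<eta> where "\<psi> = character \<eta>"
proof -
  have "\<exists>c. \<forall>t. \<psi> (t *\<^sub>R axis i 1) = cis (c * t)" for i
  proof (rule bounded_character_real[of "\<lambda>t. \<psi> (t *\<^sub>R axis i 1)" B])
    show "continuous_on UNIV (\<lambda>t. \<psi> (t *\<^sub>R axis i 1))"
      by (rule continuous_on_compose2[OF cont]) (auto intro!: continuous_intros)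
  qed (auto simp: mult scaleR_add_left one bdd)
  then obtain c where c: "\<And>i t. \<psi> (t *\<^sub>R axis i 1) = cis (c i * t)" by metis
  have sum: "\<psi> (\<Sum>i\<in>A. f i) = (\<Prod>i\<in>A. \<psi> (f i))" if "finite A" for A and f :: "'n \<Rightarrow> real ^ 'n"
    using that by (induction A rule: finite_induct) (auto simp: one mult)
  have cis_sum: "cis (\<Sum>i\<in>A. f i) = (\<Prod>i\<in>A. cis (f i))" if "finite A" for A and f :: "'n \<Rightarrow> real"
    using that by (induction A rule: finite_induct) (auto simp flip: cis_mult)
  have "\<psi> t = character (\<chi> i. c i / (2 * pi)) t" for t
  proof -
    have "\<psi> t = \<psi> (\<Sum>i\<in>UNIV. t $ i *\<^sub>R axis i 1)"
      using basis_expansion[of t] by (simp add: scalar_mult_eq_scaleR)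
    also have "\<dots> = cis (\<Sum>i\<in>UNIV. c i * t $ i)" by (simp add: sum c cis_sum)
    also have "\<dots> = character (\<chi> i. c i / (2 * pi)) t"
      by (simp add: character_def inner_vec_def sum_distrib_left mult.commute)
    finally show ?thesis .
  qed
  then show thesis by (intro that) (auto simp: fun_eq_iff)
qed

section \<open>The torus: trigonometric polynomials\<close>

abbreviation fundamental_domain :: "(real ^ 'n::finite) set" where
  "fundamental_domain \<equiv> {x. \<forall>i. 0 \<le> x $ i \<and> x $ i < 1}"

lemma fundamental_domain_sets: "(fundamental_domain :: (real ^ 'n::finite) set) \<in> sets borel"
proof -
  have "fundamental_domain = (\<Inter>i\<in>UNIV. {x::real^'n. 0 \<le> x $ i} \<inter> {x. x $ i < 1})" by auto
  also have "\<dots> \<in> sets borel"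
    by (intro sets.finite_INT sets.Int borel_closed borel_open open_Collect_less closed_Collect_le continuous_intros) auto
  finally show ?thesis .
qed

lemma finite_measure_torus: "finite_measure (torus_measure :: (real ^ 'n::finite) measure)"
proof (rule finite_measureI)
  have Q: "(fundamental_domain :: (real ^ 'n) set) \<subseteq> cbox 0 1"
    by (auto simp: mem_box_cart less_imp_le)
  have "emeasure torus_measure (space (torus_measure :: (real ^ 'n) measure)) = emeasure lebesgue (fundamental_domain :: (real ^ 'n) set)"
    using fundamental_domain_sets by (simp add: torus_measure_def emeasure_restrict_space)
  also have "\<dots> \<le> emeasure lebesgue (cbox 0 (1::real^'n))"
    using Q by (rule emeasure_mono) auto
  also have "\<dots> < \<infinity>" by (simp add: emeasure_lborel_cbox_eq)
  finally show "emeasure torus_measure (space (torus_measure :: (real ^ 'n) measure)) \<noteq> \<infinity>" by simp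
qed

lemma space_torus [simp]: "space torus_measure = fundamental_domain"
  by (simp add: torus_measure_def)

lemma continuous_imp_measurable_torus:
  "continuous_on UNIV f \<Longrightarrow> f \<in> borel_measurable torus_measure"
  unfolding torus_measure_def
  by (intro measurable_restrict_space1 measurable_completion)
    (simp add: borel_measurable_continuous_onI)

inductive trig_poly :: "(real ^ 'n::finite \<Rightarrow> complex) \<Rightarrow> bool" where
  monomial: "trig_poly (\<lambda>x. c * character (of_int_vec k) x)"
| add: "trig_poly p \<Longrightarrow> trig_poly q \<Longrightarrow> trig_poly (\<lambda>x. p x + q x)"

lemma trig_poly_const: "trig_poly (\<lambda>x. c)"
  using trig_poly.monomial[of c 0] by (simp add: character_def of_int_vec_def zero_vec_def[symmetric])

lemma trig_poly_mult:
  assumes "trig_poly p" "trig_poly q"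
  shows "trig_poly (\<lambda>x. p x * q x)"
  using assms
proof (induction arbitrary: q rule: trig_poly.induct)
  case (monomial c k)
  show ?case using monomial
  proof induction
    case (monomial d l)
    then show ?case
      using trig_poly.monomial[of "c * d" "k + l"]
      by (simp add: of_int_vec_add character_add_left mult_ac)
  next
    case (add p q)
    then show ?case using trig_poly.add[OF add.IH] by (simp add: distrib_left)
  qed
next
  case (add p p')
  then show ?case using trig_poly.add[of "\<lambda>x. p x * q x" "\<lambda>x. p' x * q x"] by (simp add: distrib_right)
qed

lemma trig_poly_sum: "finite I \<Longrightarrow> (\<And>i. i \<in> I \<Longrightarrow> trig_poly (p i)) \<Longrightarrow> trig_poly (\<lambda>x. \<Sum>i\<in>I. p i x)"
  by (induction I rule: finite_induct) (auto intro: trig_poly_const trig_poly.add)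

lemma trig_poly_lincomb:
  "trig_poly p \<Longrightarrow> trig_poly q \<Longrightarrow> trig_poly (\<lambda>x. c * p x + d * q x)"
  by (intro trig_poly.add trig_poly_mult trig_poly_const)

definition torus_embedding :: "real ^ 'n::finite \<Rightarrow> complex ^ 'n" where
  "torus_embedding x = (\<chi> i. cis (2 * pi * x $ i))"

lemma continuous_on_torus_embedding: "continuous_on S torus_embedding"
  unfolding torus_embedding_def by (intro continuous_intros)

text \<open>
  A basis vector of \<open>\<complex>\<^sup>n\<close> over the reals picks the real or imaginary part of one coordinate, that is, a
  cosine or a sine, and these are combinations of two exponentials by Euler's formula.
\<close>

lemma trig_poly_coordinate:
  assumes "b \<in> Basis"
  shows "trig_poly (\<lambda>x::real^'n::finite. of_real (torus_embedding x \<bullet> b))"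
proof -
  obtain i c where b: "b = axis i c" "c \<in> Basis" using assms by (auto simp: Basis_vec_def)
  have inner: "x \<bullet> of_int_vec (axis i 1) = x $ i" for x :: "real^'n"
    using inner_axis[of x i 1] by (simp add: of_int_vec_def axis_def of_int_vec_def if_distrib cong: if_cong)
  have pos: "trig_poly (\<lambda>x::real^'n. cis (2 * pi * x $ i))"
    using trig_poly.monomial[of 1 "axis i 1"] by (simp add: character_def inner)
  have neg: "trig_poly (\<lambda>x::real^'n. cis (- (2 * pi * x $ i)))"
    using trig_poly.monomial[of 1 "- axis i 1"] by (simp add: character_def inner of_int_vec_uminus)
  have "complex_of_real (cos y) = 1/2 * cis y + 1/2 * cis (- y)"
       "complex_of_real (sin y) = - \<i>/2 * cis y + \<i>/2 * cis (- y)" for y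
    by (auto simp: complex_eq_iff)
  then have "trig_poly (\<lambda>x::real^'n. of_real (cos (2 * pi * x $ i)))"
     "trig_poly (\<lambda>x::real^'n. of_real (sin (2 * pi * x $ i)))"
    using trig_poly_lincomb[OF pos neg, of "1/2" "1/2"]
      trig_poly_lincomb[OF pos neg, of "- \<i>/2" "\<i>/2"] by simp_all
  then show ?thesis
    using b by (auto simp: torus_embedding_def inner_axis inner_complex_def Basis_complex_def)
qed

lemma trig_poly_real_polynomial:
  assumes "real_polynomial_function p"
  shows "trig_poly (\<lambda>x::real^'n::finite. of_real (p (torus_embedding x)))"
  using assms
proof induction
  case (linear h)
  have h: "h z = (\<Sum>b\<in>Basis. (z \<bullet> b) * h b)" for z
    using linear_sum[OF bounded_linear.linear[OF linear], of "\<lambda>b. (z \<bullet> b) *\<^sub>R b" Basis]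
    by (simp add: euclidean_representation linear_scale[OF bounded_linear.linear[OF linear]])
  have eq: "(\<lambda>x. of_real (h (torus_embedding x))) =
      (\<lambda>x::real^'n. \<Sum>b\<in>Basis. of_real (torus_embedding x \<bullet> b) * complex_of_real (h b))"
    by (subst h) simp
  show ?case unfolding eq
    by (intro trig_poly_sum trig_poly_mult trig_poly_coordinate trig_poly_const) auto
next
  case (const c)
  show ?case by (rule trig_poly_const)
next
  case (add f g)
  then show ?case unfolding of_real_add by (intro trig_poly.add)
next
  case (mult f g)
  then show ?case unfolding of_real_mult by (intro trig_poly_mult)
qed

text \<open>
  This is the link with the Weierstrass theorem: a polynomial on \<open>\<complex>\<^sup>n\<close>, restricted to the product of
  unit circles, is a trigonometric polynomial in the angles.
\<close>

lemma trig_poly_polynomial_function: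
  fixes p :: "complex ^ 'n::finite \<Rightarrow> complex"
  assumes "polynomial_function p"
  shows "trig_poly (\<lambda>x. p (torus_embedding x))"
proof -
  have "real_polynomial_function (\<lambda>z. Re (p z))" "real_polynomial_function (\<lambda>z. Im (p z))"
    using assms bounded_linear_Re bounded_linear_Im unfolding polynomial_function_def o_def by blast+
  from this[THEN trig_poly_real_polynomial, THEN trig_poly_mult[OF trig_poly_const]]
  have "trig_poly (\<lambda>x. 1 * complex_of_real (Re (p (torus_embedding x))) + \<i> * complex_of_real (Im (p (torus_embedding x))))"
    by (rule trig_poly.add)
  then show ?thesis by (simp flip: complex_eq)
qed

lemma trig_poly_L1_Td: "trig_poly p \<Longrightarrow> p \<in> L1_Td \<and> continuous_on UNIV p"
proof (induction rule: trig_poly.induct)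
  case (monomial c k)
  interpret finite_measure torus_measure by (rule finite_measure_torus)
  have c: "continuous_on UNIV (\<lambda>x. c * character (of_int_vec k) x)" by (intro continuous_intros)
  have "integrable torus_measure (\<lambda>x. c * character (of_int_vec k) x)"
    by (rule integrable_const_bound[of _ "norm c"])
     (auto simp: norm_mult intro!: continuous_imp_measurable_torus c)
  with c show ?case by (auto simp: L1_Td_def character_of_int_vec_periodic)
qed (auto simp: L1_Td_def intro!: continuous_intros)

text \<open>
  The function \<open>g\<close> is not periodic, so it cannot be approximated uniformly on the whole period cube.
  On the smaller cube \<open>[0, r]\<^sup>d\<close> the embedding into the product of circles is injective, so \<open>g\<close>
  becomes a continuous function on a compact subset of \<open>\<complex>\<^sup>n\<close>. Tietze's theorem extends it with the
  same bound, and the extension is approximated by a polynomial on a ball containing the product of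
  circles. The uniform bound \<open>B + e\<close> is what controls the remaining part of the period cube.
\<close>

lemma continuous_approx_by_trig_poly_on_compact:
  fixes g :: "real ^ 'n::finite \<Rightarrow> complex"
  assumes g: "continuous_on UNIV g" "\<And>x. norm (g x) \<le> B" and r: "r < 1" and e: "e > 0"
  obtains p where "trig_poly p" "\<And>x. norm (p x) \<le> B + e"
    "\<And>x. x \<in> cbox 0 (\<chi> i. r) \<Longrightarrow> norm (p x - g x) < e"
proof -
  let ?K = "cbox 0 (\<chi> i. r) :: (real^'n) set"
  have "inj_on torus_embedding ?K"
  proof (rule inj_onI)
    fix x y :: "real^'n" assume xy: "x \<in> ?K" "y \<in> ?K" "torus_embedding x = torus_embedding y"
    have "x $ i = y $ i" for i
    proof -
      have exp: "exp (\<i> * of_real (2 * pi * x $ i)) = exp (\<i> * of_real (2 * pi * y $ i))"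
        using xy(3) by (simp add: torus_embedding_def vec_eq_iff cis_conv_exp)
      have "0 \<le> x $ i" "x $ i \<le> r" "0 \<le> y $ i" "y $ i \<le> r"
        using xy(1,2) by (simp_all add: mem_box_cart)
      then have "\<bar>x $ i - y $ i\<bar> < 1" using r by linarith
      then have "2 * pi * \<bar>x $ i - y $ i\<bar> < 2 * pi" by simp
      also have "2 * pi * \<bar>x $ i - y $ i\<bar> = \<bar>2 * pi * x $ i - 2 * pi * y $ i\<bar>"
        by (simp add: abs_mult flip: right_diff_distrib)
      finally have "\<i> * of_real (2 * pi * x $ i) = \<i> * of_real (2 * pi * y $ i)"
        by (intro exp_complex_eqI[OF _ exp]) simp
      then show ?thesis by simp
    qed
    then show "x = y" by (simp add: vec_eq_iff)
  qed
  then have inv: "\<forall>x\<in>?K. inv_into ?K torus_embedding (torus_embedding x) = x" by simp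
  have "continuous_on (torus_embedding ` ?K) (inv_into ?K torus_embedding)"
    by (rule continuous_on_inv[OF continuous_on_torus_embedding compact_cbox inv])
  then have cont: "continuous_on (torus_embedding ` ?K) (\<lambda>z. g (inv_into ?K torus_embedding z))"
    by (rule continuous_on_compose2[OF g(1)]) auto
  have cpt: "compact (torus_embedding ` S)" if "compact S" for S :: "(real^'n) set"
    by (rule compact_continuous_image[OF continuous_on_torus_embedding that])
  have B: "0 \<le> B" using g(2)[of 0] norm_ge_zero order_trans by blast
  obtain F where F: "continuous_on UNIV F" "\<And>z. z \<in> torus_embedding ` ?K \<Longrightarrow> F z = g (inv_into ?K torus_embedding z)"
      "\<And>z. norm (F z) \<le> B"
    by (rule Tietze[OF cont, where U=UNIV and B=B]) (use B compact_imp_closed[OF cpt[OF compact_cbox]] g in auto)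
  have range: "torus_embedding x \<in> cball 0 (real CARD('n))" for x :: "real^'n"
    using L2_set_le_sum[of UNIV "\<lambda>i. norm (torus_embedding x $ i)"]
    by (simp add: norm_vec_def torus_embedding_def)
  obtain q where q: "polynomial_function q" "\<And>z. z \<in> cball 0 (real CARD('n)) \<Longrightarrow> norm (F z - q z) < e"
    using Stone_Weierstrass_polynomial_function[OF compact_cball continuous_on_subset[OF F(1) subset_UNIV] e] by metis
  show thesis
  proof
    show "trig_poly (\<lambda>x. q (torus_embedding x))" by (rule trig_poly_polynomial_function[OF q(1)])
    fix x
    have near: "norm (F (torus_embedding x) - q (torus_embedding x)) < e" using q(2) range by blast
    then show "norm (q (torus_embedding x)) \<le> B + e"
      using F(3)[of "torus_embedding x"] norm_triangle_ineq3[of "q (torus_embedding x)" "F (torus_embedding x)"]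
      by (simp add: norm_minus_commute)
    show "norm (q (torus_embedding x) - g x) < e" if "x \<in> ?K"
      using near F(2)[of "torus_embedding x"] inv that by (simp add: norm_minus_commute)
  qed
qed

text \<open>
  A diagonal choice: the \<open>n\<close>-th trigonometric polynomial is within \<open>1/(n+1)\<close> of the \<open>n\<close>-th
  continuous approximant on \<open>[0, 1 - 1/(n+1)]\<^sup>d\<close>. These cubes exhaust \<open>[0, 1)\<^sup>d\<close>, so there is
  convergence almost everywhere, dominated by a constant.
\<close>

lemma trig_poly_dense_bounded:
  fixes f :: "real ^ 'n::finite \<Rightarrow> complex"
  assumes f: "f \<in> borel_measurable torus_measure" "\<And>x. norm (f x) \<le> B"
  obtains p where "\<And>n::nat. trig_poly (p n)" "(\<lambda>n. L1_norm torus_measure (\<lambda>t. p n t - f t)) \<longlonglongrightarrow> 0"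
proof -
  let ?Q = "fundamental_domain :: (real^'n) set"
  have Q: "?Q \<in> sets lebesgue" using fundamental_domain_sets by auto
  let ?F = "\<lambda>x. if x \<in> ?Q then f x else 0"
  have B: "0 \<le> B" using f(2)[of 0] norm_ge_zero order_trans by blast
  have "?F \<in> borel_measurable lebesgue"
    using f(1) Q unfolding torus_measure_def by (intro borel_measurable_if_I) auto
  then obtain g where g: "\<And>n::nat. continuous_on UNIV (g n)" "\<And>n x. norm (g n x) \<le> B"
    "AE x in lebesgue. (\<lambda>n. g n x) \<longlonglongrightarrow> ?F x"
    by (rule bounded_measurable_limit_of_continuous[where B=B]) (use f B in auto)
  let ?r = "\<lambda>n. 1 - inverse (real (Suc n))"
  have "\<exists>p. trig_poly p \<and> (\<forall>x. norm (p x) \<le> B + inverse (real (Suc n))) \<and>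
      (\<forall>x\<in>cbox 0 (\<chi> i. ?r n). norm (p x - g n x) < inverse (real (Suc n)))" for n
    by (rule continuous_approx_by_trig_poly_on_compact[OF g(1,2), of "?r n" "inverse (real (Suc n))" n]) auto
  then obtain p where p: "\<And>n. trig_poly (p n)" "\<And>n x. norm (p n x) \<le> B + inverse (real (Suc n))"
      "\<And>n x. x \<in> cbox 0 (\<chi> i. ?r n) \<Longrightarrow> norm (p n x - g n x) < inverse (real (Suc n))"
    by metis
  interpret finite_measure "torus_measure :: (real^'n) measure" by (rule finite_measure_torus)
  have "(\<lambda>n. L1_norm torus_measure (\<lambda>t. p n t - f t)) \<longlonglongrightarrow> 0"
  proof (rule L1_norm_tendsto_0_dominated)
    show "p n \<in> borel_measurable torus_measure" for n
      using trig_poly_L1_Td[OF p(1)] continuous_imp_measurable_torus by blast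
    show "AE x in torus_measure. norm (p n x) \<le> B + 1" for n
      by (rule AE_I2, rule order_trans[OF p(2)]) (simp add: inverse_eq_divide)
    have "AE x in torus_measure. (\<lambda>n. g n x) \<longlonglongrightarrow> ?F x"
      using g(3) Q unfolding torus_measure_def by (subst AE_restrict_space_iff) (auto elim: AE_mp)
    then show "AE x in torus_measure. (\<lambda>n. p n x) \<longlonglongrightarrow> f x"
      using AE_space
    proof eventually_elim
      case (elim x)
      then have x: "x \<in> ?Q" by simp
      have r: "?r \<longlonglongrightarrow> 1" using tendsto_diff[OF tendsto_const LIMSEQ_inverse_real_of_nat, of 1] by simp
      have "\<forall>\<^sub>F n in sequentially. \<forall>i. x $ i < ?r n"
        using x by (intro eventually_all_finite order_tendstoD(1)[OF r]) auto
      then have ev: "\<forall>\<^sub>F n in sequentially. norm (p n x - g n x) \<le> inverse (real (Suc n))"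
        by eventually_elim (use x p(3) in \<open>auto simp: mem_box_cart less_imp_le\<close>)
      have "(\<lambda>n. p n x - g n x) \<longlonglongrightarrow> 0"
        by (rule Lim_null_comparison[OF ev LIMSEQ_inverse_real_of_nat])
      from tendsto_add[OF this elim(1)] show ?case using x by simp
    qed
    show "AE x in torus_measure. norm (f x) \<le> B + 1"
      by (rule AE_I2) (use f(2) in \<open>auto intro: order_trans[of _ B]\<close>)
  qed (use f in auto)
  with p(1) that show thesis by blast
qed

lemma L1_continuous_vanishing_on_trig_poly:
  fixes f :: "real ^ 'n::finite \<Rightarrow> complex"
  assumes m: "L1_continuous torus_measure L1_Td m" and z: "\<And>p. trig_poly p \<Longrightarrow> m p = 0"
    and f: "f \<in> L1_Td"
  shows "m f = 0"
proof -
  have fi: "integrable torus_measure f" using f by (simp add: L1_Td_def)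
  let ?S = "\<lambda>n::nat. {x. norm (f x) \<le> real n}"
  let ?f = "\<lambda>n t. indicator (?S n) t * f t"
  have S1: "{x \<in> space torus_measure. x \<in> ?S n} \<in> sets torus_measure" for n
    using fi unfolding mem_Collect_eq by measurable
  have S2: "\<forall>\<^sub>F n in sequentially. x \<in> ?S n" for x
    using eventually_ge_at_top[of "nat \<lceil>norm (f x)\<rceil>"] by eventually_elim (simp add: nat_ceiling_le_eq)
  have fL: "?f n \<in> L1_Td" for n
    using L1_norm_truncation_tendsto_0(2)[OF fi S1 S2] f by (auto simp: L1_Td_def indicator_def)
  have "m (?f n) = 0" for n
  proof -
    obtain p where p: "\<And>j::nat. trig_poly (p j)" "(\<lambda>j. L1_norm torus_measure (\<lambda>t. p j t - ?f n t)) \<longlonglongrightarrow> 0"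
      by (rule trig_poly_dense_bounded[of "?f n" "real n"]) (use fL[of n] in \<open>auto simp: L1_Td_def indicator_def\<close>)
    show ?thesis
      by (rule L1_continuous_eqI[OF m L1_continuous_zero fL _ p(2)]) (use p(1) z trig_poly_L1_Td in auto)
  qed
  then show ?thesis
    by (intro L1_continuous_eqI[OF m L1_continuous_zero f fL L1_norm_truncation_tendsto_0(1)[OF fi S1 S2]]) auto
qed

text \<open>
  The exponentials satisfy \<open>f * e\<^sub>k = c e\<^sub>k\<close>, where \<open>c\<close> is the \<open>k\<close>-th Fourier coefficient of \<open>f\<close>;
  dividing \<open>m(f) m(e\<^sub>k) = c m(e\<^sub>k)\<close> by \<open>m(e\<^sub>k)\<close> gives \<open>m(f) = c\<close> as soon as some \<open>m(e\<^sub>k)\<close> is non-zero.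
\<close>

lemma multiplicative_functional_on_L1_Td:
  fixes m :: "(real ^ 'n::finite \<Rightarrow> complex) \<Rightarrow> complex"
  assumes cont: "L1_continuous torus_measure L1_Td m"
    and add: "\<And>f g. f \<in> L1_Td \<Longrightarrow> g \<in> L1_Td \<Longrightarrow> m (\<lambda>t. f t + g t) = m f + m g"
    and scale: "\<And>c f. f \<in> L1_Td \<Longrightarrow> m (\<lambda>t. c * f t) = c * m f"
    and conv: "\<And>f g. f \<in> L1_Td \<Longrightarrow> g \<in> L1_Td \<Longrightarrow> m (convolution torus_measure f g) = m f * m g"
  shows "(\<forall>f\<in>L1_Td. m f = 0) \<or> (\<exists>k. \<forall>f\<in>L1_Td. m f = fourier torus_measure f (of_int_vec k))"
proof -
  have e: "character (of_int_vec k) \<in> L1_Td" for k :: "int^'n"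
    using trig_poly_L1_Td[OF trig_poly.monomial[of 1 k]] by simp
  show ?thesis
  proof (cases "\<exists>k. m (character (of_int_vec k)) \<noteq> 0")
    case True
    then obtain k where k: "m (character (of_int_vec k)) \<noteq> 0" by blast
    have "m f = fourier torus_measure f (of_int_vec k)" if f: "f \<in> L1_Td" for f
    proof -
      have "convolution torus_measure f (character (of_int_vec k)) =
          (\<lambda>x. fourier torus_measure f (of_int_vec k) * character (of_int_vec k) x)"
        by (simp add: fun_eq_iff convolution_def fourier_eq character_diff mult.left_commute mult.commute
           flip: integral_mult_right_zero)
      then show ?thesis using conv[OF f e[of k]] scale[OF e[of k]] k by simp
    qed
    then show ?thesis by blast
  next
    case False
    have "m p = 0" if "trig_poly p" for p
      using that
    proof induction
      case (monomial c k)
      then show ?case using scale[OF e[of k]] False by simp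
    next
      case (add p q)
      then show ?case using assms(2) trig_poly_L1_Td by fastforce
    qed
    then show ?thesis using L1_continuous_vanishing_on_trig_poly[OF cont] by blast
  qed
qed

section \<open>Continuous functions with compact support\<close>

definition Cc :: "('a::euclidean_space \<Rightarrow> complex) set" where
  "Cc = {f. continuous_on UNIV f \<and> (\<exists>R. \<forall>x. norm x > R \<longrightarrow> f x = 0)}"

lemma CcE:
  assumes "f \<in> Cc"
  obtains R where "0 \<le> R" "\<And>x. norm x > R \<Longrightarrow> f x = 0"
proof -
  obtain R where "\<forall>x. norm x > R \<longrightarrow> f x = 0" using assms by (auto simp: Cc_def)
  then show thesis by (intro that[of "max R 0"]) auto
qed

lemma Cc_continuous: "f \<in> Cc \<Longrightarrow> continuous_on S f"
  by (auto simp: Cc_def intro: continuous_on_subset)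

text \<open>
  Points at distance less than \<open>1\<close> either both lie in the ball of radius \<open>R + 1\<close>, which is compact, or
  both lie outside the ball of radius \<open>R\<close>, where \<open>f\<close> vanishes.
\<close>

lemma Cc_uniformly_continuous:
  assumes "f \<in> Cc"
  shows "uniformly_continuous_on UNIV f"
proof -
  obtain R where R: "0 \<le> R" "\<And>x. norm x > R \<Longrightarrow> f x = 0" using assms by (rule CcE) blast
  have uc: "uniformly_continuous_on (cball 0 (R + 1)) f"
    by (rule compact_uniformly_continuous[OF Cc_continuous[OF assms]]) simp
  show ?thesis
    unfolding uniformly_continuous_on_def
  proof (intro allI impI)
    fix e :: real assume e: "e > 0"
    then obtain d where d: "d > 0" "\<And>x y. x \<in> cball 0 (R + 1) \<Longrightarrow> y \<in> cball 0 (R + 1) \<Longrightarrow> dist y x < d \<Longrightarrow> dist (f y) (f x) < e"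
      using uc unfolding uniformly_continuous_on_def by meson
    have "dist (f y) (f x) < e" if xy: "dist y x < min d 1" for x y
    proof (cases "norm x \<le> R + 1 \<and> norm y \<le> R + 1")
      case True
      then show ?thesis using d xy by auto
    next
      case False
      have "\<bar>norm y - norm x\<bar> < 1" using xy norm_triangle_ineq3[of y x] by (simp add: dist_norm)
      with False have "norm x > R" "norm y > R" by linarith+
      then show ?thesis using R e by simp
    qed
    then show "\<exists>d>0. \<forall>x\<in>UNIV. \<forall>y\<in>UNIV. dist y x < d \<longrightarrow> dist (f y) (f x) < e"
      using d(1) by (intro exI[of _ "min d 1"]) auto
  qed
qed

lemma Cc_bounded:
  assumes "f \<in> Cc"
  obtains B where "0 \<le> B" "\<And>x. norm (f x) \<le> B"
proof -
  obtain R where R: "\<And>x. norm x > R \<Longrightarrow> f x = 0" using assms by (rule CcE) blast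
  have "bounded (f ` cball 0 R)"
    by (intro compact_imp_bounded compact_continuous_image Cc_continuous assms) simp
  then obtain B where B: "\<And>x. norm x \<le> R \<Longrightarrow> norm (f x) \<le> B" unfolding bounded_iff by fastforce
  have "norm (f x) \<le> max B 0" for x using R[of x] B[of x] by (cases "norm x \<le> R") auto
  then show thesis by (intro that[of "max B 0"]) auto
qed

lemma bounded_support_integrable:
  fixes w :: "'a::euclidean_space \<Rightarrow> complex"
  assumes w: "w \<in> borel_measurable lebesgue" and b: "\<And>x. norm (w x) \<le> b" and P: "\<And>x. norm x > P \<Longrightarrow> w x = 0"
  shows "integrable lebesgue w" "L1_norm lebesgue w \<le> b * measure lebesgue (cball (0::'a) P)"
proof -
  have i: "integrable lebesgue (\<lambda>x::'a. b * indicator (cball 0 P) x)"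
    using emeasure_compact_finite[OF compact_cball, of 0 P]
    by (intro integrable_mult_right integrable_real_indicator) auto
  have le: "norm (w x) \<le> b * indicator (cball 0 P) x" for x
    using b[of x] P[of x] by (cases "norm x \<le> P") (auto simp: indicator_def)
  show w': "integrable lebesgue w"
    by (rule Bochner_Integration.integrable_bound[OF i w]) (rule AE_I2, rule order_trans[OF le], simp)
  have "L1_norm lebesgue w \<le> (LINT x|lebesgue. b * indicator (cball (0::'a) P) x)"
    unfolding L1_norm_def by (rule integral_mono) (use w' i le in auto)
  then show "L1_norm lebesgue w \<le> b * measure lebesgue (cball (0::'a) P)" by simp
qed

lemma Cc_measurable: "f \<in> Cc \<Longrightarrow> f \<in> borel_measurable borel"
  by (auto simp: Cc_def intro: borel_measurable_continuous_onI)

lemma Cc_integrable: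
  assumes f: "f \<in> Cc"
  shows "integrable lebesgue f"
proof -
  obtain R where "\<And>x. norm x > R \<Longrightarrow> f x = 0" using f by (rule CcE) blast
  moreover obtain B where "\<And>x. norm (f x) \<le> B" using f by (rule Cc_bounded) blast
  moreover have "f \<in> borel_measurable lebesgue"
    using Cc_measurable[OF f] by (intro measurable_completion) simp
  ultimately show ?thesis by (intro bounded_support_integrable(1))
qed

lemma Cc_L1_Rd: "f \<in> Cc \<Longrightarrow> f \<in> L1_Rd"
  by (simp add: L1_Rd_def Cc_integrable)

lemma Cc_translate:
  assumes "u \<in> Cc" shows "(\<lambda>x. u (x - t)) \<in> Cc"
proof -
  obtain R where R: "\<And>x. norm x > R \<Longrightarrow> u x = 0" using assms by (rule CcE) blast
  have "u (x - t) = 0" if "norm x > R + norm t" for x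
    using that norm_triangle_ineq2[of x t] by (intro R) linarith
  moreover have "continuous_on UNIV (\<lambda>x. u (x - t))"
    by (rule continuous_on_compose2[OF Cc_continuous[OF assms, of UNIV]]) (auto intro!: continuous_intros)
  ultimately show ?thesis unfolding Cc_def by blast
qed

lemma Cc_mult:
  assumes "u \<in> Cc" "continuous_on UNIV g" shows "(\<lambda>x. u x * g x) \<in> Cc"
proof -
  obtain R where R: "\<And>x. norm x > R \<Longrightarrow> u x = 0" using assms(1) by (rule CcE) blast
  moreover have "continuous_on UNIV (\<lambda>x. u x * g x)"
    by (intro continuous_intros assms Cc_continuous)
  ultimately show ?thesis unfolding Cc_def by fastforce
qed

lemma Cc_lebesgue_integral_eq:
  assumes f: "f \<in> Cc" and z: "\<And>x. x \<notin> S \<Longrightarrow> f x = 0"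
  shows "(LINT x|lebesgue. f x) = integral S f"
proof -
  have "(LINT x|lebesgue. f x) = integral UNIV f"
    using integral_lebesgue[OF Cc_integrable[OF f]] by simp
  also have "\<dots> = integral UNIV (\<lambda>x. if x \<in> S then f x else 0)" using z by (intro arg_cong[where f="integral UNIV"]) auto
  finally show ?thesis by (simp add: Henstock_Kurzweil_Integration.integral_restrict_UNIV)
qed

lemma lebesgue_integral_translation:
  fixes h :: "'a::euclidean_space \<Rightarrow> 'b::{banach, second_countable_topology}"
  assumes h: "h \<in> borel_measurable borel"
  shows "(LINT x|lebesgue. h (x - t)) = (LINT x|lebesgue. h x)"
proof -
  have "(LINT x|lebesgue. h x) = (LINT x|distr lborel borel ((+) (- t)). h x)"
    using h by (simp add: integral_completion lborel_distr_plus)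
  also have "\<dots> = (LINT x|lborel. h (x - t))"
    using h by (subst integral_distr) auto
  also have "\<dots> = (LINT x|lebesgue. h (x - t))"
    using h by (subst integral_completion) auto
  finally show ?thesis by simp
qed

lemma L1_norm_translate: "u \<in> Cc \<Longrightarrow> L1_norm lebesgue (\<lambda>x. u (x - t)) = L1_norm lebesgue u"
  unfolding L1_norm_def by (rule lebesgue_integral_translation) (auto dest: Cc_measurable)

text \<open>
  Substituting \<open>y + s\<close> for the integration variable moves both translations to the second factor.
\<close>

lemma convolution_translate:
  assumes "u \<in> Cc"
  shows "convolution lebesgue (\<lambda>x. u (x - s)) (\<lambda>x. u (x - t)) = convolution lebesgue u (\<lambda>x. u (x - (s + t)))"
proof
  fix x
  have "(\<lambda>y. u y * u (x - y - (s + t))) \<in> borel_measurable borel"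
    by (intro borel_measurable_times measurable_compose[OF _ Cc_measurable[OF assms]] Cc_measurable[OF assms]) measurable
  from lebesgue_integral_translation[OF this, of s]
  show "convolution lebesgue (\<lambda>x. u (x - s)) (\<lambda>x. u (x - t)) x = convolution lebesgue u (\<lambda>x. u (x - (s + t))) x"
    by (simp add: convolution_def algebra_simps)
qed

text \<open>
  The continuous approximants are multiplied by a cutoff that is \<open>1\<close> on the ball of radius \<open>R\<close> and \<open>0\<close>
  outside the ball of radius \<open>R + 1\<close>, so that a constant times the indicator of the larger ball
  dominates them.
\<close>

lemma Cc_dense_bounded_support:
  fixes f :: "'a::euclidean_space \<Rightarrow> complex"
  assumes f: "f \<in> borel_measurable lebesgue" and B: "\<And>x. norm (f x) \<le> B" and R: "\<And>x. norm x > R \<Longrightarrow> f x = 0"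
  obtains g where "\<And>n::nat. g n \<in> Cc" "(\<lambda>n. L1_norm lebesgue (\<lambda>t. g n t - f t)) \<longlonglongrightarrow> 0"
proof -
  obtain h where h: "\<And>n::nat. continuous_on UNIV (h n)" "\<And>n x. norm (h n x) \<le> B"
    "AE x in lebesgue. (\<lambda>n. h n x) \<longlonglongrightarrow> f x"
    by (rule bounded_measurable_limit_of_continuous[OF f B]) blast
  define k :: "'a \<Rightarrow> real" where "k x = max 0 (min 1 (R + 1 - norm x))" for x
  have k: "0 \<le> k x" "k x \<le> 1" for x by (auto simp: k_def)
  have kc: "continuous_on UNIV k" unfolding k_def by (intro continuous_intros)
  have k1: "k x = 1" if "norm x \<le> R" for x using that by (simp add: k_def)
  define g where "g n x = of_real (k x) * h n x" for n x
  have gC: "g n \<in> Cc" for n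
  proof -
    have "continuous_on UNIV (g n)" unfolding g_def by (intro continuous_intros kc h)
    moreover have "g n x = 0" if "norm x > R + 1" for x using that by (simp add: g_def k_def)
    ultimately show ?thesis unfolding Cc_def by blast
  qed
  have B0: "0 \<le> B" using B[of 0] norm_ge_zero order_trans by blast
  have gB: "norm (g n x) \<le> B * indicator (cball 0 (R + 1)) x" for n x
  proof (cases "norm x \<le> R + 1")
    case True
    have "norm (g n x) \<le> 1 * B" unfolding g_def norm_mult by (intro mult_mono) (use k h B0 in auto)
    then show ?thesis using True by simp
  next
    case False
    then show ?thesis by (simp add: g_def k_def)
  qed
  have "(\<lambda>n. L1_norm lebesgue (\<lambda>t. g n t - f t)) \<longlonglongrightarrow> 0"
  proof (rule L1_norm_tendsto_0_dominated[OF f])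
    show "g n \<in> borel_measurable lebesgue" for n
      using Cc_measurable[OF gC] by (intro measurable_completion) simp
    show "integrable lebesgue (\<lambda>x::'a. B * indicator (cball 0 (R + 1)) x)"
      using emeasure_compact_finite[OF compact_cball, of 0 "R + 1"]
      by (intro integrable_mult_right integrable_real_indicator) auto
    show "AE x in lebesgue. (\<lambda>n. g n x) \<longlonglongrightarrow> f x"
      using h(3)
    proof eventually_elim
      case (elim x)
      then have "(\<lambda>n. g n x) \<longlonglongrightarrow> of_real (k x) * f x" unfolding g_def by (intro tendsto_intros)
      moreover have "of_real (k x) * f x = f x" using k1[of x] R[of x] by (cases "norm x \<le> R") auto
      ultimately show ?case by simp
    qed
    show "AE x in lebesgue. norm (f x) \<le> B * indicator (cball 0 (R + 1)) x"
    proof (rule AE_I2)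
      fix x show "norm (f x) \<le> B * indicator (cball 0 (R + 1)) x"
        using B[of x] R[of x] B0 by (cases "norm x \<le> R") (auto simp: indicator_def)
    qed
    show "AE x in lebesgue. norm (g n x) \<le> B * indicator (cball 0 (R + 1)) x" for n
      using gB by simp
  qed
  with gC show thesis by (rule that)
qed

lemma L1_continuous_eq_on_Cc:
  fixes f :: "real ^ 'n::finite \<Rightarrow> complex"
  assumes m: "L1_continuous lebesgue L1_Rd m" "L1_continuous lebesgue L1_Rd m'"
    and eq: "\<And>p. p \<in> Cc \<Longrightarrow> m p = m' p" and f: "f \<in> L1_Rd"
  shows "m f = m' f"
proof -
  have fi: "integrable lebesgue f" using f by (simp add: L1_Rd_def)
  let ?S = "\<lambda>n::nat. {x. norm (f x) \<le> real n \<and> norm x \<le> real n}"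
  let ?f = "\<lambda>n t. indicator (?S n) t * f t"
  have S1: "{x \<in> space lebesgue. x \<in> ?S n} \<in> sets lebesgue" for n
  proof -
    have "{x \<in> space lebesgue. norm (f x) \<le> real n} \<in> sets lebesgue" using fi by measurable
    moreover have "cball 0 (real n) \<in> sets (lebesgue :: (real^'n) measure)" by auto
    ultimately have "{x \<in> space lebesgue. norm (f x) \<le> real n} \<inter> cball 0 (real n) \<in> sets lebesgue" by (rule sets.Int)
    then show ?thesis by (simp add: Int_def)
  qed
  have S2: "\<forall>\<^sub>F n in sequentially. x \<in> ?S n" for x
    using eventually_ge_at_top[of "nat \<lceil>max (norm (f x)) (norm x)\<rceil>"] by eventually_elim (simp add: nat_ceiling_le_eq)
  have fL: "?f n \<in> L1_Rd" for n
    using L1_norm_truncation_tendsto_0(2)[OF fi S1 S2] by (simp add: L1_Rd_def)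
  have "m (?f n) = m' (?f n)" for n
  proof -
    obtain p where p: "\<And>j::nat. p j \<in> Cc" "(\<lambda>j. L1_norm lebesgue (\<lambda>t. p j t - ?f n t)) \<longlonglongrightarrow> 0"
      by (rule Cc_dense_bounded_support[of "?f n" "real n" "real n"]) (use fL[of n] in \<open>auto simp: L1_Rd_def indicator_def\<close>)
    show ?thesis
      by (rule L1_continuous_eqI[OF m fL _ p(2)]) (use p(1) eq Cc_L1_Rd in auto)
  qed
  then show ?thesis
    by (intro L1_continuous_eqI[OF m f fL L1_norm_truncation_tendsto_0(1)[OF fi S1 S2]])
qed

section \<open>Multiplicative functionals on \<open>L\<^sup>1(\<real>\<^sup>d)\<close>\<close>

text \<open>
  Completeness makes it possible to integrate functions with values in the bounded continuous
  functions, which is how a convolution is written as a superposition of translates.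
\<close>

instance bcontfun :: (metric_space, banach) banach ..

lemma bcontfun_of_Cc_apply:
  assumes "f \<in> Cc"
  shows "apply_bcontfun (Bcontfun f) = f"
proof (rule Bcontfun_inverse)
  obtain B where "\<And>x. norm (f x) \<le> B" using assms by (rule Cc_bounded) blast
  then show "f \<in> bcontfun" by (rule bcontfun_normI[OF Cc_continuous[OF assms]])
qed

lemma bounded_linear_apply_bcontfun: "bounded_linear (\<lambda>w. apply_bcontfun w x)"
  by (rule bounded_linear_intro[where K=1]) (auto simp: norm_bounded)

text \<open>
  This describes \<open>f \<mapsto> T f \<xi>\<close> for a fixed \<open>\<xi>\<close>. The bound also makes the functional insensitive to
  changes on null sets.
\<close>

locale L1_multiplicative_functional =
  fixes m :: "(real ^ 'n::finite \<Rightarrow> complex) \<Rightarrow> complex" and C :: real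
  assumes add: "f \<in> L1_Rd \<Longrightarrow> g \<in> L1_Rd \<Longrightarrow> m (\<lambda>t. f t + g t) = m f + m g"
    and scale: "f \<in> L1_Rd \<Longrightarrow> m (\<lambda>t. c * f t) = c * m f"
    and C_nonneg: "0 \<le> C"
    and bound: "f \<in> L1_Rd \<Longrightarrow> norm (m f) \<le> C * L1_norm lebesgue f"
    and conv: "f \<in> L1_Rd \<Longrightarrow> g \<in> L1_Rd \<Longrightarrow> m (convolution lebesgue f g) = m f * m g"
begin

lemma diff: "f \<in> L1_Rd \<Longrightarrow> g \<in> L1_Rd \<Longrightarrow> m (\<lambda>t. f t - g t) = m f - m g"
  using add[of f "\<lambda>t. - 1 * g t"] scale[of g "-1"] by (simp add: L1_Rd_def)

text \<open>
  On functions supported in a fixed ball the functional is continuous even for uniform convergence.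
  This is what allows it to act on integrals in the sup norm.
\<close>

lemma bound_of_bounded_support:
  assumes "w \<in> borel_measurable lebesgue" "\<And>x. norm (w x) \<le> b" "\<And>x. norm x > P \<Longrightarrow> w x = 0"
  shows "norm (m w) \<le> b * (C * measure lebesgue (cball (0::real^'n) P))"
proof -
  have "norm (m w) \<le> C * L1_norm lebesgue w"
    by (rule bound) (use bounded_support_integrable(1)[OF assms] in \<open>simp add: L1_Rd_def\<close>)
  also have "\<dots> \<le> C * (b * measure lebesgue (cball (0::real^'n) P))"
    by (intro mult_left_mono bounded_support_integrable(2)[OF assms] C_nonneg)
  finally show ?thesis by (simp add: mult_ac)
qed

text \<open>
  Translates by \<open>t\<close> and \<open>s\<close> with \<open>|t - s| < 1\<close> are supported in one ball, and there they are uniformly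
  close by uniform continuity.
\<close>

lemma continuous_on_translate:
  assumes u: "u \<in> Cc"
  shows "continuous_on UNIV (\<lambda>t. m (\<lambda>x. u (x - t)))"
  unfolding continuous_on_iff
proof (intro ballI allI impI)
  fix s :: "real^'n" and e :: real assume e: "e > 0"
  obtain R where R: "\<And>x. norm x > R \<Longrightarrow> u x = 0" using u by (rule CcE) blast
  define V where "V = C * measure lebesgue (cball (0::real^'n) (R + norm s + 1))"
  have V: "0 \<le> V" using C_nonneg by (simp add: V_def)
  obtain d where d: "d > 0" "\<And>x y. dist y x < d \<Longrightarrow> dist (u y) (u x) < e / (V + 1)"
    using Cc_uniformly_continuous[OF u] V e unfolding uniformly_continuous_on_def
    by (metis UNIV_I add_nonneg_pos divide_pos_pos zero_less_one)
  have "dist (m (\<lambda>x. u (x - t))) (m (\<lambda>x. u (x - s))) < e" if t: "dist t s < min d 1" for t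
  proof -
    have nt: "norm t < norm s + 1" using t norm_triangle_ineq2[of t s] by (simp add: dist_norm)
    have "dist (m (\<lambda>x. u (x - t))) (m (\<lambda>x. u (x - s))) = norm (m (\<lambda>x. u (x - t) - u (x - s)))"
      by (simp add: dist_norm diff Cc_L1_Rd Cc_translate u)
    also have "\<dots> \<le> e / (V + 1) * (C * measure lebesgue (cball (0::real^'n) (R + norm s + 1)))"
    proof (rule bound_of_bounded_support)
      show "(\<lambda>x. u (x - t) - u (x - s)) \<in> borel_measurable lebesgue"
        by (intro borel_measurable_diff measurable_completion Cc_measurable Cc_translate u)
           (auto intro: Cc_measurable Cc_translate u)
      show "norm (u (x - t) - u (x - s)) \<le> e / (V + 1)" for x
        using d(2)[of "x - t" "x - s"] t by (simp add: dist_norm norm_minus_commute less_imp_le)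
      show "u (x - t) - u (x - s) = 0" if "norm x > R + norm s + 1" for x
        using that nt norm_triangle_ineq2[of x t] norm_triangle_ineq2[of x s] by (simp add: R)
    qed
    also have "\<dots> < e" unfolding V_def[symmetric] using V e by (simp add: field_simps)
    finally show ?thesis .
  qed
  then show "\<exists>d>0. \<forall>t\<in>UNIV. dist t s < d \<longrightarrow> dist (m (\<lambda>x. u (x - t))) (m (\<lambda>x. u (x - s))) < e"
    using d(1) by (intro exI[of _ "min d 1"]) auto
qed

text \<open>
  Cutting off to a ball turns the functional into a bounded real-linear functional on the Banach space
  of bounded continuous functions.
\<close>

lemma bounded_linear_on_bcontfun:
  "bounded_linear (\<lambda>w::(real^'n) \<Rightarrow>\<^sub>C complex. m (\<lambda>x. indicator (cball 0 P) x * apply_bcontfun w x))"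
proof -
  have meas: "(\<lambda>x. indicator (cball 0 P) x * apply_bcontfun w x) \<in> borel_measurable lebesgue"
    for w :: "(real^'n) \<Rightarrow>\<^sub>C complex"
    by (intro measurable_completion borel_measurable_times borel_measurable_indicator)
      (auto intro: borel_measurable_continuous_onI)
  have nb: "norm (indicator (cball 0 P) x * apply_bcontfun w x) \<le> norm w" for x and w :: "(real^'n) \<Rightarrow>\<^sub>C complex"
    by (auto simp: indicator_def norm_bounded)
  have L: "(\<lambda>x. indicator (cball 0 P) x * apply_bcontfun w x) \<in> L1_Rd" for w :: "(real^'n) \<Rightarrow>\<^sub>C complex"
    using bounded_support_integrable(1)[OF meas nb, of P] by (auto simp: L1_Rd_def)
  show ?thesis
  proof (rule bounded_linear_intro[where K="C * measure lebesgue (cball (0::real^'n) P)"])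
    show "norm (m (\<lambda>x. indicator (cball 0 P) x * apply_bcontfun w x))
        \<le> norm w * (C * measure lebesgue (cball (0::real^'n) P))" for w
      by (rule bound_of_bounded_support[OF meas nb]) auto
    show "m (\<lambda>x. indicator (cball 0 P) x * apply_bcontfun (w + v) x) =
        m (\<lambda>x. indicator (cball 0 P) x * apply_bcontfun w x) + m (\<lambda>x. indicator (cball 0 P) x * apply_bcontfun v x)" for w v
      using add[OF L L, of w v] by (simp add: distrib_left)
    show "m (\<lambda>x. indicator (cball 0 P) x * apply_bcontfun (r *\<^sub>R w) x) =
        r *\<^sub>R m (\<lambda>x. indicator (cball 0 P) x * apply_bcontfun w x)" for r w
      using scale[OF L, of "of_real r" w] by (simp add: scaleR_conv_of_real mult.left_commute)
  qed
qed

text \<open>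
  The convolution is the integral of the curve \<open>H(t) = f(t) u\<^sub>t\<close> in the Banach space of bounded
  continuous functions, taken over a box containing the support of \<open>f\<close>: evaluation at \<open>x\<close> is bounded
  linear, so it commutes with the integral and gives \<open>(f * u)(x)\<close>. All the functions \<open>H(t)\<close> live in one
  ball, on which \<open>m\<close> is bounded for the sup norm; hence \<open>m\<close> commutes with the same integral.
\<close>

lemma functional_of_convolution:
  assumes f: "f \<in> Cc" and u: "u \<in> Cc"
  shows "m (convolution lebesgue f u) = (LINT t|lebesgue. f t * m (\<lambda>x. u (x - t)))"
proof -
  obtain R where R: "0 \<le> R" "\<And>x. norm x > R \<Longrightarrow> f x = 0" using f by (rule CcE) blast
  obtain S where S: "0 \<le> S" "\<And>x. norm x > S \<Longrightarrow> u x = 0" using u by (rule CcE) blast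
  define P where "P = R + S"
  have hz: "f t * u (x - t) = 0" if "norm t > R \<or> norm x > P" for t x
    using that R(2)[of t] S(2)[of "x - t"] norm_triangle_ineq2[of x t] by (cases "norm t > R") (auto simp: P_def)
  \<comment> \<open>Uniform continuity of this function of two variables is the sup-norm continuity of \<open>H\<close>.\<close>
  have h: "(\<lambda>(t, x). f t * u (x - t)) \<in> Cc"
    unfolding Cc_def
  proof (intro CollectI conjI exI allI impI)
    show "continuous_on UNIV (\<lambda>(t, x). f t * u (x - t))"
      unfolding case_prod_beta
      by (intro continuous_intros continuous_on_compose2[OF Cc_continuous[OF f, of UNIV]]
          continuous_on_compose2[OF Cc_continuous[OF u, of UNIV]]) auto
    show "(case z of (t, x) \<Rightarrow> f t * u (x - t)) = 0" if z: "norm z > R + P" for z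
    proof -
      have "norm (fst z) > R \<or> norm (snd z) > P"
        using norm_Pair_le[of "fst z" "snd z"] z by (auto simp: not_le)
      then show ?thesis using hz by (simp add: case_prod_beta)
    qed
  qed
  have hC: "(\<lambda>x. f t * u (x - t)) \<in> Cc" for t
    using Cc_mult[OF Cc_translate[OF u], of "\<lambda>_. f t" t] by (simp add: mult.commute)
  define H where "H t = Bcontfun (\<lambda>x. f t * u (x - t))" for t
  have H: "apply_bcontfun (H t) = (\<lambda>x. f t * u (x - t))" for t
    unfolding H_def by (rule bcontfun_of_Cc_apply[OF hC])
  have H_cont: "continuous_on UNIV H"
    unfolding continuous_on_iff
  proof (intro ballI allI impI)
    fix s and e :: real assume "e > 0"
    then obtain d where d: "d > 0" "\<And>t t' x x'. dist (t', x') (t, x) < d \<Longrightarrow> dist (f t' * u (x' - t')) (f t * u (x - t)) < e / 2"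
      using Cc_uniformly_continuous[OF h, unfolded uniformly_continuous_on_def, rule_format, of "e / 2"] by auto
    have "dist (H t) (H s) < e" if "dist t s < d" for t
    proof -
      have "dist (H t) (H s) \<le> e / 2"
        by (rule dist_bound) (use that d(2)[of t _ s] in \<open>simp add: H dist_Pair_Pair less_imp_le\<close>)
      then show ?thesis using \<open>e > 0\<close> by simp
    qed
    then show "\<exists>d>0. \<forall>t\<in>UNIV. dist t s < d \<longrightarrow> dist (H t) (H s) < e" using d(1) by blast
  qed
  obtain a where a: "cball (0::real^'n) R \<subseteq> cbox (- a) a"
    by (rule bounded_subset_cbox_symmetric[OF bounded_cball])
  then have fz: "f t = 0" if "t \<notin> cbox (- a) a" for t using that R(2)[of t] by (cases "norm t > R") (auto simp: subset_iff)
  have H_int: "H integrable_on cbox (- a) a"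
    by (rule integrable_continuous, rule continuous_on_subset[OF H_cont]) simp
  define I where "I = integral (cbox (- a) a) H"
  have I: "apply_bcontfun I x = convolution lebesgue f u x" for x
  proof -
    have "apply_bcontfun I x = integral (cbox (- a) a) (\<lambda>t. f t * u (x - t))"
      using integral_linear[OF H_int bounded_linear_apply_bcontfun[of x]] by (simp add: I_def o_def H)
    also have "\<dots> = convolution lebesgue f u x"
      unfolding convolution_def
      by (rule Cc_lebesgue_integral_eq[symmetric], rule Cc_mult[OF f])
       (auto simp: fz intro!: continuous_on_compose2[OF Cc_continuous[OF u, of UNIV]] continuous_intros)
    finally show ?thesis .
  qed
  have "convolution lebesgue f u = (\<lambda>x. indicator (cball 0 P) x * apply_bcontfun I x)"
  proof
    fix x show "convolution lebesgue f u x = indicator (cball 0 P) x * apply_bcontfun I x"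
    proof (cases "norm x \<le> P")
      case True
      then show ?thesis by (simp add: I)
    next
      case False
      then have "(\<lambda>t. f t * u (x - t)) = (\<lambda>_. 0)" using hz[of _ x] by (simp add: fun_eq_iff)
      then show ?thesis using False by (simp add: convolution_def)
    qed
  qed
  then have "m (convolution lebesgue f u) = m (\<lambda>x. indicator (cball 0 P) x * apply_bcontfun I x)" by simp
  also have "\<dots> = integral (cbox (- a) a) (\<lambda>t. m (\<lambda>x. indicator (cball 0 P) x * (f t * u (x - t))))"
    using integral_linear[OF H_int bounded_linear_on_bcontfun[of P]] by (simp add: I_def o_def H)
  also have "(\<lambda>t. m (\<lambda>x. indicator (cball 0 P) x * (f t * u (x - t)))) = (\<lambda>t. f t * m (\<lambda>x. u (x - t)))"
  proof
    fix t
    have "(\<lambda>x. indicator (cball 0 P) x * (f t * u (x - t))) = (\<lambda>x. f t * u (x - t))"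
      using hz[of t] by (force simp: indicator_def)
    then show "m (\<lambda>x. indicator (cball 0 P) x * (f t * u (x - t))) = f t * m (\<lambda>x. u (x - t))"
      using scale[OF Cc_L1_Rd[OF Cc_translate[OF u, of t]]] by simp
  qed
  also have "integral (cbox (- a) a) \<dots> = (LINT t|lebesgue. f t * m (\<lambda>x. u (x - t)))"
    by (rule Cc_lebesgue_integral_eq[symmetric], rule Cc_mult[OF f continuous_on_translate[OF u]]) (simp add: fz)
  finally show ?thesis .
qed

end

context L1_multiplicative_functional
begin

text \<open>
  The quotient \<open>\<psi>(t) = m(u\<^sub>t) / m(u)\<close> is a bounded continuous character, because translation preserves
  the \<open>L\<^sup>1\<close> norm and \<open>u\<^sub>s * u\<^sub>t = u * u\<^sub>s\<^sub>+\<^sub>t\<close>. The frequency is \<open>- \<zeta>\<close> because the Fourier transform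
  integrates against the conjugate character.
\<close>

lemma fourier_on_Cc:
  assumes u: "u \<in> Cc" "m u \<noteq> 0"
  obtains \<eta> where "\<And>f. f \<in> Cc \<Longrightarrow> m f = fourier lebesgue f \<eta>"
proof -
  define \<psi> where "\<psi> t = m (\<lambda>x. u (x - t)) / m u" for t
  note tr = Cc_L1_Rd[OF Cc_translate[OF u(1)]]
  have "\<psi> (s + t) = \<psi> s * \<psi> t" for s t
  proof -
    have "m (\<lambda>x. u (x - s)) * m (\<lambda>x. u (x - t)) = m u * m (\<lambda>x. u (x - (s + t)))"
      using conv[OF tr tr, of s t] conv[OF Cc_L1_Rd[OF u(1)] tr, of "s + t"] convolution_translate[OF u(1), of s t] by simp
    then show ?thesis using u(2) by (simp add: \<psi>_def field_simps)
  qed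
  moreover have "continuous_on UNIV \<psi>"
    unfolding \<psi>_def by (intro continuous_on_divide continuous_on_translate u) (auto simp: u)
  moreover have "\<psi> 0 = 1" using u(2) by (simp add: \<psi>_def)
  moreover have "norm (\<psi> t) \<le> C * L1_norm lebesgue u / norm (m u)" for t
    using bound[OF tr, of t] u by (simp add: \<psi>_def norm_divide L1_norm_translate divide_right_mono)
  ultimately obtain \<zeta> where \<zeta>: "\<psi> = character \<zeta>"
    using bounded_character_vec[of \<psi>] by metis
  have "m f = fourier lebesgue f (- \<zeta>)" if f: "f \<in> Cc" for f
  proof -
    have "m (\<lambda>x. u (x - t)) = m u * character \<zeta> t" for t
      using u(2) unfolding \<zeta>[symmetric] \<psi>_def by simp
    then have "m f * m u = (LINT t|lebesgue. m u * (f t * character \<zeta> t))"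
      using conv[OF Cc_L1_Rd[OF f] Cc_L1_Rd[OF u(1)]] functional_of_convolution[OF f u(1)]
      by (simp add: mult.left_commute)
    also have "\<dots> = m u * fourier lebesgue f (- \<zeta>)" by (simp add: fourier_eq)
    finally show ?thesis using u(2) by simp
  qed
  then show thesis by (rule that)
qed

lemma zero_or_fourier:
  assumes cont: "L1_continuous lebesgue L1_Rd m"
  shows "(\<forall>f\<in>L1_Rd. m f = 0) \<or> (\<exists>\<eta>. \<forall>f\<in>L1_Rd. m f = fourier lebesgue f \<eta>)"
proof (cases "\<exists>u\<in>Cc. m u \<noteq> 0")
  case True
  then obtain \<eta> where \<eta>: "\<And>f. f \<in> Cc \<Longrightarrow> m f = fourier lebesgue f \<eta>" using fourier_on_Cc by blast
  have meas: "character (- \<eta>) \<in> borel_measurable lebesgue"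
    using borel_measurable_continuous_onI[OF continuous_on_character] by (intro measurable_completion) simp
  have "L1_continuous lebesgue L1_Rd (\<lambda>f. fourier lebesgue f \<eta>)"
    unfolding fourier_eq
    by (rule L1_continuous_integral_against_bounded[where B=1]) (auto simp: L1_Rd_def meas)
  from L1_continuous_eq_on_Cc[OF cont this \<eta>] show ?thesis by blast
next
  case False
  from L1_continuous_eq_on_Cc[OF cont L1_continuous_zero] False show ?thesis by blast
qed

end

section \<open>Homomorphisms from \<open>L\<^sup>1(G)\<close>\<close>

theorem theorem3p1:
  "(\<forall>T :: (real ^ 'n::finite \<Rightarrow> complex) \<Rightarrow> (real ^ 'n \<Rightarrow> complex).
      (\<forall>f\<in>L1_Rd. continuous_on UNIV (T f)) \<and>
      linear_on_L1 lebesgue L1_Rd T \<and>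
      continuous_on_L1 lebesgue L1_Rd {K. compact K} T \<and>
      multiplicative_on_L1 lebesgue L1_Rd T \<longrightarrow>
      (\<exists>(E :: (real ^ 'n) set) (\<phi> :: real ^ 'n \<Rightarrow> real ^ 'n). \<forall>f\<in>L1_Rd. \<forall>\<xi>.
         T f \<xi> = indicator E \<xi> * fourier lebesgue f (\<phi> \<xi>))) \<and>
   (\<forall>T :: (real ^ 'n \<Rightarrow> complex) \<Rightarrow> (int ^ 'n \<Rightarrow> complex).
      (\<forall>f\<in>L1_Td. bounded (range (T f))) \<and>
      linear_on_L1 torus_measure L1_Td T \<and>
      continuous_on_L1 torus_measure L1_Td {UNIV} T \<and>
      multiplicative_on_L1 torus_measure L1_Td T \<longrightarrow>
      (\<exists>(E :: (int ^ 'n) set) (\<phi> :: int ^ 'n \<Rightarrow> int ^ 'n). \<forall>f\<in>L1_Td. \<forall>\<xi>.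
         T f \<xi> = indicator E \<xi> * fourier torus_measure f (of_int_vec (\<phi> \<xi>))))"
proof (intro conjI allI impI; elim conjE)
  fix T :: "(real ^ 'n \<Rightarrow> complex) \<Rightarrow> (real ^ 'n \<Rightarrow> complex)"
  assume T: "linear_on_L1 lebesgue L1_Rd T" "continuous_on_L1 lebesgue L1_Rd {K. compact K} T"
    "multiplicative_on_L1 lebesgue L1_Rd T"
  show "\<exists>(E :: (real ^ 'n) set) \<phi>. \<forall>f\<in>L1_Rd. \<forall>\<xi>. T f \<xi> = indicator E \<xi> * fourier lebesgue f (\<phi> \<xi>)"
  proof (rule pointwise_zero_or_transform)
    fix \<xi> :: "real ^ 'n"
    obtain C where C: "0 \<le> C" "\<And>f. f \<in> L1_Rd \<Longrightarrow> norm (T f \<xi>) \<le> C * L1_norm lebesgue f"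
      by (rule linear_continuous_imp_bounded[OF T(1,2), of "{\<xi>}" \<xi>]) (auto simp: L1_Rd_def)
    interpret L1_multiplicative_functional "\<lambda>f. T f \<xi>" C
      by (rule L1_multiplicative_functional.intro[OF linear_on_L1_add[OF T(1)]
            linear_on_L1_scale[OF T(1)] C multiplicative_on_L1_convolution[OF T(3)]])
    show "(\<forall>f\<in>L1_Rd. T f \<xi> = 0) \<or> (\<exists>\<eta>. \<forall>f\<in>L1_Rd. T f \<xi> = fourier lebesgue f \<eta>)"
      by (rule zero_or_fourier[OF continuous_on_L1_imp_L1_continuous[OF T(2), of "{\<xi>}"]]) auto
  qed
next
  fix T :: "(real ^ 'n \<Rightarrow> complex) \<Rightarrow> (int ^ 'n \<Rightarrow> complex)"
  assume T: "linear_on_L1 torus_measure L1_Td T" "continuous_on_L1 torus_measure L1_Td {UNIV} T"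
    "multiplicative_on_L1 torus_measure L1_Td T"
  show "\<exists>(E :: (int ^ 'n) set) \<phi>. \<forall>f\<in>L1_Td. \<forall>\<xi>.
      T f \<xi> = indicator E \<xi> * fourier torus_measure f (of_int_vec (\<phi> \<xi>))"
  proof (rule pointwise_zero_or_transform[where F="\<lambda>f k. fourier torus_measure f (of_int_vec k)"])
    fix \<xi> :: "int ^ 'n"
    show "(\<forall>f\<in>L1_Td. T f \<xi> = 0) \<or> (\<exists>k. \<forall>f\<in>L1_Td. T f \<xi> = fourier torus_measure f (of_int_vec k))"
    proof (rule multiplicative_functional_on_L1_Td)
      show "L1_continuous torus_measure L1_Td (\<lambda>f. T f \<xi>)"
        by (rule continuous_on_L1_imp_L1_continuous[OF T(2)]) auto
    qed (rule linear_on_L1_add[OF T(1)] linear_on_L1_scale[OF T(1)]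
          multiplicative_on_L1_convolution[OF T(3)]; assumption)+
  qed
qed

end
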